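(* Let $(G_j)_{j\ge 1}$ be a sequence of graphs with maximum degree $\Delta(G_j)\le 3$, let $(k_j)_{j\ge1}$ be a sequence of positive integers, and let $u_j\in V(G_j)$ be vertices such that $f(G_j,u_j,k_j)\to\infty$ as $j\to\infty$. For each $j$, assign to the edges of $G_j$ independent random weights, each distributed according to the exponential distribution with rate $1$. Let $H_j$ be the weight of a heaviest path of length $k_j$ in $G_j$ starting from $u_j$, and let $L_j$ be the weight of a lightest path of length $k_j$ in $G_j$ starting from $u_j$. Then, as $j\to\infty$, $$\mathbb{E}[H_j]\ge (1-o(1))\left(k_j+\frac{\log_2 f(G_j,u_j,k_j)}{2}\right)$$ and $$\mathbb{E}[L_j]\le (1+o(1))\left(k_j-\frac{\log_2 f(G_j,u_j,k_j)}{2}\right).$$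
   Context: The length of a path is the number of its vertices (not edges); a path has distinct vertices. For a graph $G$, a vertex $u_0\in V(G)$ and a positive integer $k$, $f(G,u_0,k)$ denotes the number of paths of length $k$ (i.e. with $k$ vertices) in $G$ starting from $u_0$. The weight of a path is the sum of the weights of its edges. Here $o(1)$ denotes a quantity tending to $0$ as $j\to\infty$. *)

theory Defs
  imports "HOL-Probability.Probability"
begin

definition simple_graph :: "'a set \<Rightarrow> 'a set set \<Rightarrow> bool" where
  "simple_graph V E \<longleftrightarrow> (\<forall>e\<in>E. \<exists>u\<in>V. \<exists>v\<in>V. u \<noteq> v \<and> e = {u, v})"

text \<open>Vertex sets may be infinite, so finiteness of each neighbourhood is required explicitly:
  \<^const>\<open>card\<close> is \<open>0\<close> on infinite sets.\<close>
definition max_degree_le :: "'a set \<Rightarrow> 'a set set \<Rightarrow> nat \<Rightarrow> bool" where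
  "max_degree_le V E d \<longleftrightarrow> (\<forall>v\<in>V. finite {w. {v, w} \<in> E} \<and> card {w. {v, w} \<in> E} \<le> d)"

text \<open>Path length counts vertices: a path of length \<open>k\<close> has \<open>k - 1\<close> edges.\<close>
definition paths_from :: "'a set \<Rightarrow> 'a set set \<Rightarrow> 'a \<Rightarrow> nat \<Rightarrow> 'a list set" where
  "paths_from V E u k =
     {p. p \<noteq> [] \<and> hd p = u \<and> length p = k \<and> distinct p \<and> set p \<subseteq> V \<and>
         successively (\<lambda>x y. {x, y} \<in> E) p}"

definition num_paths :: "'a set \<Rightarrow> 'a set set \<Rightarrow> 'a \<Rightarrow> nat \<Rightarrow> nat" where
  "num_paths V E u k = card (paths_from V E u k)"

definition path_edges :: "'a list \<Rightarrow> 'a set set" where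
  "path_edges p = {{p ! i, p ! Suc i} | i. Suc i < length p}"

definition path_weight :: "('a set \<Rightarrow> real) \<Rightarrow> 'a list \<Rightarrow> real" where
  "path_weight w p = (\<Sum>e\<in>path_edges p. w e)"

text \<open>The two extremal weights are meaningful only if there is a path of length \<open>k\<close> from \<open>u\<close>
  (and only finitely many, which bounded degree guarantees).\<close>
definition heaviest_weight :: "'a set \<Rightarrow> 'a set set \<Rightarrow> 'a \<Rightarrow> nat \<Rightarrow> ('a set \<Rightarrow> real) \<Rightarrow> real" where
  "heaviest_weight V E u k w = Max (path_weight w ` paths_from V E u k)"

definition lightest_weight :: "'a set \<Rightarrow> 'a set set \<Rightarrow> 'a \<Rightarrow> nat \<Rightarrow> ('a set \<Rightarrow> real) \<Rightarrow> real" where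
  "lightest_weight V E u k w = Min (path_weight w ` paths_from V E u k)"

end

theory Submission
  imports Defs "HOL-Real_Asymp.Real_Asymp"
begin

text \<open>The paths are the leaves of the tree of self-avoiding walks from the start vertex, in which every
  vertex but the root has at most two children. An edge leading from a vertex to one of its children
  is not used further down in the tree, so its weight is independent of the extremal weights of the
  subtrees.

  At a vertex whose subtrees contain \<open>a\<close> and \<open>b\<close> leaves, descend into the first one with probability
  \<open>p = a / (a + b)\<close>, as a uniformly random leaf would, but decide this by comparing the weights \<open>X\<close>, \<open>Y\<close>
  of the two edges: descend into the first subtree iff \<open>X - Y\<close> exceeds the appropriate threshold.
  Relative to an edge of mean weight this gains \<open>p * (1 - ln (2 * p))\<close> if \<open>p \<le> 1/2\<close>, which is at least
  half the binary entropy of \<open>p\<close>. By the chain rule the entropies add up to the base 2 logarithm of the number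
  of leaves. Negating all weights turns lightest paths into heaviest ones and leaves the comparison
  intact because \<open>X - Y\<close> is symmetric. Both bounds therefore hold up to an additive constant,
  and for lightest paths the constant is absorbed by counting \<open>k\<close> instead of \<open>k - 1\<close> edges.\<close>

subsection \<open>Binary entropy and the gain of a switch\<close>

definition bin_entropy :: "real \<Rightarrow> real" where
  "bin_entropy p = - (p * log 2 p + (1 - p) * log 2 (1 - p))"

lemma bin_entropy_compl: "bin_entropy (1 - p) = bin_entropy p"
  by (simp add: bin_entropy_def)

text \<open>Chain rule for entropy: a uniform choice among \<open>a + b\<close> leaves is a choice
  of the side followed by a uniform choice within it. The logarithms of the two shares split off a
  common \<open>log 2 (a + b)\<close>.\<close>

lemma log2_add_eq_bin_entropy:
  assumes "0 < a" "0 < b" and p: "p = a / (a + b)"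
  shows "p * log 2 a + (1 - p) * log 2 b + bin_entropy p = log 2 (a + b)"
proof -
  have q: "1 - p = b / (a + b)"
    using assms by (simp add: field_simps)
  have "log 2 p = log 2 a - log 2 (a + b)" "log 2 (1 - p) = log 2 b - log 2 (a + b)"
    unfolding q using assms by (simp_all add: log_divide)
  then show ?thesis
    unfolding bin_entropy_def by (simp only:) (simp add: algebra_simps)
qed

text \<open>A concave function lies above its chords; here the chord of \<open>ln\<close> over
  [1/2, 1], at the point 1 - p = 2p * 1/2 + (1 - 2p) * 1. It settles the sign of a derivative
  below.\<close>

lemma ln_one_minus_ge_chord:
  fixes p :: real
  assumes "0 \<le> p" "p \<le> 1/2"
  shows "- 2 * p * ln 2 \<le> ln (1 - p)"
proof -
  have "concave_on {0<..} (ln :: real \<Rightarrow> real)"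
    by (simp add: ln_concave)
  from concave_onD[OF this, of "2 * p" 1 "1/2"] assms
  show ?thesis
    by (simp add: ln_div algebra_simps)
qed

text \<open>Divided by \<open>p\<close>, the difference of the two sides is decreasing on \<open>(0, 1/2]\<close>, and it vanishes at
  \<open>1/2\<close>.\<close>
lemma bin_entropy_le_gain:
  assumes "0 < p" "p \<le> 1/2"
  shows "bin_entropy p / 2 \<le> p * (1 - ln (2 * p))"
proof -
  \<comment> \<open>\<open>c\<close> turns half a base 2 logarithm into a natural one, and
    \<open>G\<close> is the gain minus half the entropy, divided by the probability.\<close>
  define c :: real where "c = 1 / (2 * ln 2)"
  have cl: "c * ln 2 = 1/2"
    by (simp add: c_def)
  define G where "G x = 1 - ln 2 - (1 - c) * ln x + c * ((1 - x) / x * ln (1 - x))" for x :: real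
  have "G (1/2) \<le> G p"
  proof (rule DERIV_nonpos_imp_nonincreasing[of p "1/2" G])
    show "p \<le> 1/2" by fact
    fix x :: real assume x: "p \<le> x" "x \<le> 1/2"
    have x0: "0 < x" "x < 1" using x assms by auto
    have deriv: "(G has_real_derivative - (x + c * ln (1 - x)) / x\<^sup>2) (at x)"
      unfolding G_def using x0
      apply (auto intro!: derivative_eq_intros)
      apply (simp add: divide_simps power2_eq_square)
      apply (simp add: algebra_simps)
      done
    \<comment> \<open>The derivative has the opposite sign to x + c ln (1 - x); multiplied by
      \<open>c\<close>, the chord bound becomes exactly -x.\<close>
    have "c * (- 2 * x * ln 2) \<le> c * ln (1 - x)"
      using ln_one_minus_ge_chord[of x] x x0
      by (intro mult_left_mono) (auto simp: c_def)
    moreover have "c * (- 2 * x * ln 2) = - x"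
      using cl by algebra
    ultimately have "0 \<le> x + c * ln (1 - x)"
      by linarith
    with deriv show "\<exists>y. (G has_real_derivative y) (at x) \<and> y \<le> 0"
      by (intro exI conjI) (auto simp: divide_nonpos_nonneg)
  qed
  moreover have "G (1/2) = 0"
    using cl by (simp add: G_def ln_div algebra_simps)
  ultimately have "0 \<le> p * G p"
    using assms by simp
  moreover have "p * G p = p * (1 - ln (2 * p)) - bin_entropy p / 2"
    using assms by (simp add: G_def bin_entropy_def log_def c_def ln_mult field_simps)
  ultimately show ?thesis
    by simp
qed

subsection \<open>Switching between two independent weights\<close>

text \<open>The antiderivative \<open>F\<close> is explicit. An affine integrand covers both later
  uses: the mass of a tail (\<open>d = 0\<close>) and the mean excess over it
  (\<open>c = 0\<close>).\<close>

lemma nn_integral_exp_tail: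
  fixes a c d :: real
  assumes "0 \<le> c" "0 \<le> d" and r: "0 \<le> r"
  shows "(\<integral>\<^sup>+x. ennreal ((c + d * (x - a + r)) * exp (- x)) * indicator {a..} x \<partial>lborel)
    = ennreal ((c + d * (r + 1)) * exp (- a))"
proof -
  define F where "F x = - (c + d * (x - a + r + 1)) * exp (- x)" for x :: real
  have "(\<integral>\<^sup>+x. ennreal ((c + d * (x - a + r)) * exp (- x)) * indicator {a..} x \<partial>lborel) = ennreal (0 - F a)"
  proof (rule nn_integral_FTC_atLeast)
    show "(F \<longlongrightarrow> 0) at_top"
      unfolding F_def by real_asymp
    show "(F has_real_derivative (c + d * (x - a + r)) * exp (- x)) (at x)" for x
      unfolding F_def by (auto intro!: derivative_eq_intros simp: algebra_simps)
  qed (use assms in auto)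
  then show ?thesis
    by (simp add: F_def algebra_simps)
qed

context prob_space
begin

text \<open>Given \<open>Y = y\<close>, the event says that \<open>X\<close> is at least
  \<open>y + t\<close>; this has probability \<open>exp (- (y + t))\<close>, and by memorylessness
  \<open>X - y\<close> then has mean \<open>t + 1\<close>. Averaging with density
  \<open>exp (- y)\<close> leaves the integral of \<open>exp (- (2 * y))\<close>, which is
  1/2.\<close>

lemma exponential_pair_tail:
  assumes X: "distributed M lborel X (exponential_density 1)"
    and Y: "distributed M lborel Y (exponential_density 1)"
    and ind: "indep_var borel X borel Y"
    and "0 \<le> t" "0 \<le> c" "0 \<le> d"
  shows "(\<integral>\<^sup>+\<omega>. ennreal (c + d * (X \<omega> - Y \<omega>)) * indicator {(x, y). t \<le> x - y} (X \<omega>, Y \<omega>) \<partial>M)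
    = ennreal ((c + d * (t + 1)) * exp (- t) / 2)"
proof -
  let ?g = "\<lambda>(x, y). ennreal (c + d * (x - y)) * indicator {(x, y). t \<le> x - y} (x, y :: real)"
  let ?f = "\<lambda>x. ennreal (exponential_density 1 x)"
  have "{z \<in> space (borel \<Otimes>\<^sub>M borel). t \<le> fst z - snd z} \<in> sets (borel \<Otimes>\<^sub>M borel)"
    by measurable
  then have [measurable]: "{(x, y). t \<le> x - y} \<in> sets (borel \<Otimes>\<^sub>M borel)"
    by (simp add: space_pair_measure case_prod_beta')
  have [measurable]: "?g \<in> borel_measurable (borel \<Otimes>\<^sub>M borel)"
    by measurable
  have ind': "indep_var lborel X lborel Y"
    using ind unfolding indep_var_eq by simp
  have XY: "distributed M (lborel \<Otimes>\<^sub>M lborel) (\<lambda>\<omega>. (X \<omega>, Y \<omega>)) (\<lambda>(x, y). ?f x * ?f y)"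
    by (rule distributed_joint_indep[OF _ _ X Y ind']) (auto intro: lborel.sigma_finite_measure_axioms)
  have inner: "(\<integral>\<^sup>+x. ?f x * ?f y * ?g (x, y) \<partial>lborel)
      = ennreal ((c + d * (t + 1)) * exp (- t)) * (ennreal (exp (- (2 * y))) * indicator {0..} y)" for y
  proof (cases "0 \<le> y")
    case True
    have "(\<integral>\<^sup>+x. ?f x * ?f y * ?g (x, y) \<partial>lborel)
        = (\<integral>\<^sup>+x. ennreal (exp (- y)) *
            (ennreal ((c + d * (x - (y + t) + t)) * exp (- x)) * indicator {y + t..} x) \<partial>lborel)"
      using assms True
      by (intro nn_integral_cong)
        (auto simp: exponential_density_def indicator_def ennreal_mult[symmetric] mult_ac simp del: ennreal_plus)
    also have "\<dots> = ennreal (exp (- y)) * ennreal ((c + d * (t + 1)) * exp (- (y + t)))"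
      using assms by (subst nn_integral_cmult) (auto simp only: nn_integral_exp_tail, measurable)
    also have "\<dots> = ennreal ((c + d * (t + 1)) * exp (- t)) * ennreal (exp (- (2 * y)))"
    proof -
      have "exp (- y) * exp (- (y + t)) = exp (- t) * exp (- (2 * y))"
        by (simp add: exp_add[symmetric])
      then have "exp (- y) * ((c + d * (t + 1)) * exp (- (y + t)))
          = (c + d * (t + 1)) * exp (- t) * exp (- (2 * y))"
        by (metis mult.assoc mult.left_commute)
      then show ?thesis
        using assms by (simp only: ennreal_mult[symmetric] exp_ge_zero mult_nonneg_nonneg add_nonneg_nonneg zero_le_one)
    qed
    finally show ?thesis
      using True by simp
  qed (simp add: exponential_density_def)
  have "(\<integral>\<^sup>+\<omega>. ?g (X \<omega>, Y \<omega>) \<partial>M)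
      = (\<integral>\<^sup>+z. (case z of (x, y) \<Rightarrow> ?f x * ?f y) * ?g z \<partial>(lborel \<Otimes>\<^sub>M lborel))"
    by (rule distributed_nn_integral[OF XY, symmetric]) simp
  also have "\<dots> = (\<integral>\<^sup>+y. \<integral>\<^sup>+x. ?f x * ?f y * ?g (x, y) \<partial>lborel \<partial>lborel)"
    by (subst lborel_pair.nn_integral_snd[symmetric]) (auto intro!: nn_integral_cong)
  also have "\<dots> = ennreal ((c + d * (t + 1)) * exp (- t)) *
      (\<integral>\<^sup>+y. ennreal (exp (- (2 * y))) * indicator {0..} y \<partial>lborel)"
    unfolding inner by (subst nn_integral_cmult) auto
  also have "(\<integral>\<^sup>+y. ennreal (exp (- (2 * y))) * indicator {0..} y \<partial>lborel) = ennreal (0 - - exp (- (2 * 0)) / 2)"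
  proof (rule nn_integral_FTC_atLeast)
    show "((\<lambda>y::real. - exp (- (2 * y)) / 2) \<longlongrightarrow> 0) at_top"
      by real_asymp
  qed (auto intro!: derivative_eq_intros)
  also have "ennreal ((c + d * (t + 1)) * exp (- t)) * ennreal (0 - - exp (- (2 * 0)) / 2)
      = ennreal ((c + d * (t + 1)) * exp (- t) / 2)"
    using assms by (subst ennreal_mult[symmetric]) auto
  finally show ?thesis
    by simp
qed

text \<open>\<open>T\<close> is a switching rule: take \<open>X\<close> instead of \<open>Y\<close>
  when the pair falls into \<open>T\<close>. A set in the plane makes the rule a function of these
  two weights alone, so that independence from other weights carries over to it. The gain is
  measured against always taking \<open>Y\<close>.\<close>

definition switchable :: "('a \<Rightarrow> real) \<Rightarrow> ('a \<Rightarrow> real) \<Rightarrow> real \<Rightarrow> bool" where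
  "switchable X Y p \<longleftrightarrow> (\<exists>T\<in>sets (borel \<Otimes>\<^sub>M borel). prob {\<omega>\<in>space M. (X \<omega>, Y \<omega>) \<in> T} = p \<and>
     bin_entropy p / 2 \<le> expectation (\<lambda>\<omega>. indicator T (X \<omega>, Y \<omega>) * (X \<omega> - Y \<omega>)))"

lemma integrable_indicator_mult:
  assumes [measurable]: "X \<in> borel_measurable M" "Y \<in> borel_measurable M" "T \<in> sets (borel \<Otimes>\<^sub>M borel)"
    and A: "integrable M (A :: 'a \<Rightarrow> real)"
  shows "integrable M (\<lambda>\<omega>. indicator T (X \<omega>, Y \<omega> :: real) * A \<omega>)"
proof (rule Bochner_Integration.integrable_bound[OF A])
  show "(\<lambda>\<omega>. indicator T (X \<omega>, Y \<omega>) * A \<omega>) \<in> borel_measurable M"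
    using A by measurable
qed (auto simp: indicator_def)

text \<open>The complementary rule works: pointwise its gain is the old gain plus
  \<open>Y - X\<close>, which has mean 0, and the entropy is symmetric.\<close>

lemma switchable_swap:
  assumes X: "integrable M X" and Y: "integrable M Y" and eq: "expectation X = expectation Y"
    and "switchable X Y p"
  shows "switchable Y X (1 - p)"
proof -
  have [measurable]: "X \<in> borel_measurable M" "Y \<in> borel_measurable M"
    using X Y by auto
  obtain T where T[measurable]: "T \<in> sets (borel \<Otimes>\<^sub>M borel)"
    and p: "prob {\<omega>\<in>space M. (X \<omega>, Y \<omega>) \<in> T} = p"
    and gain: "bin_entropy p / 2 \<le> expectation (\<lambda>\<omega>. indicator T (X \<omega>, Y \<omega>) * (X \<omega> - Y \<omega>))"
    using assms(4) unfolding switchable_def by blast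
  let ?T = "{z \<in> space (borel \<Otimes>\<^sub>M borel). (snd z, fst z) \<notin> T}"
  show ?thesis
    unfolding switchable_def
  proof (intro bexI conjI)
    show "?T \<in> sets (borel \<Otimes>\<^sub>M borel)"
      by measurable
    have "{\<omega>\<in>space M. (Y \<omega>, X \<omega>) \<in> ?T} = space M - {\<omega>\<in>space M. (X \<omega>, Y \<omega>) \<in> T}"
      by (auto simp: space_pair_measure)
    moreover have "{\<omega>\<in>space M. (X \<omega>, Y \<omega>) \<in> T} \<in> events"
      by measurable
    ultimately show "prob {\<omega>\<in>space M. (Y \<omega>, X \<omega>) \<in> ?T} = 1 - p"
      by (simp add: prob_compl p)
    have "expectation (\<lambda>\<omega>. indicator ?T (Y \<omega>, X \<omega>) * (Y \<omega> - X \<omega>))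
        = expectation (\<lambda>\<omega>. indicator T (X \<omega>, Y \<omega>) * (X \<omega> - Y \<omega>) + (Y \<omega> - X \<omega>))"
      by (intro Bochner_Integration.integral_cong) (auto simp: indicator_def space_pair_measure)
    also have "\<dots> = expectation (\<lambda>\<omega>. indicator T (X \<omega>, Y \<omega>) * (X \<omega> - Y \<omega>))"
      using X Y eq by (subst Bochner_Integration.integral_add) (auto intro!: integrable_indicator_mult)
    finally show "bin_entropy (1 - p) / 2 \<le> expectation (\<lambda>\<omega>. indicator ?T (Y \<omega>, X \<omega>) * (Y \<omega> - X \<omega>))"
      using gain by (simp add: bin_entropy_compl)
  qed
qed

text \<open>Since (-X) - (-Y) = Y - X, the rule for \<open>Y\<close> against \<open>X\<close> still
  serves after transport along (x, y) -> (-y, -x). This carries the gain over to lightest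
  paths.\<close>

lemma switchable_uminus:
  assumes "switchable Y X p"
  shows "switchable (\<lambda>\<omega>. - X \<omega>) (\<lambda>\<omega>. - Y \<omega>) p"
proof -
  obtain T where T[measurable]: "T \<in> sets (borel \<Otimes>\<^sub>M borel)"
    and T': "prob {\<omega>\<in>space M. (Y \<omega>, X \<omega>) \<in> T} = p"
      "bin_entropy p / 2 \<le> expectation (\<lambda>\<omega>. indicator T (Y \<omega>, X \<omega>) * (Y \<omega> - X \<omega>))"
    using assms unfolding switchable_def by blast
  have "{z \<in> space (borel \<Otimes>\<^sub>M borel). (- snd z, - fst z) \<in> T} \<in> sets (borel \<Otimes>\<^sub>M borel)"
    by measurable
  then show ?thesis
    using T' unfolding switchable_def
    by (intro bexI[of _ "{z \<in> space (borel \<Otimes>\<^sub>M borel). (- snd z, - fst z) \<in> T}"])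
      (auto simp: indicator_def space_pair_measure)
qed

text \<open>Switching to \<open>X\<close> exactly when it exceeds \<open>Y\<close> by \<open>t = - ln (2 * p)\<close> happens with probability
  \<open>exp (- t) / 2 = p\<close>, and by memorylessness the excess is then \<open>t + 1\<close> on average.\<close>
lemma switchable_exponential_le_half:
  assumes X: "distributed M lborel X (exponential_density 1)"
    and Y: "distributed M lborel Y (exponential_density 1)"
    and ind: "indep_var borel X borel Y"
    and int: "integrable M X" "integrable M Y"
    and p: "0 < p" "p \<le> 1/2"
  shows "switchable X Y p"
proof -
  define t where "t = - ln (2 * p)"
  have t: "0 \<le> t" "exp (- t) / 2 = p"
    using p by (auto simp: t_def)
  let ?T = "{z \<in> space (borel \<Otimes>\<^sub>M borel). t \<le> fst z - snd z}"
  have T[measurable]: "?T \<in> sets (borel \<Otimes>\<^sub>M borel)"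
    by measurable
  have [measurable]: "X \<in> borel_measurable M" "Y \<in> borel_measurable M"
    using int by auto
  have T_eq: "{(x, y). t \<le> x - y} = ?T"
    by (simp add: space_pair_measure case_prod_beta')
  \<comment> \<open>Used twice: \<open>c = 1\<close>, \<open>d = 0\<close> gives the probability of
    the switch, \<open>c = 0\<close>, \<open>d = 1\<close> its expected gain.\<close>
  note tail = exponential_pair_tail[OF X Y ind t(1), unfolded T_eq]
  have "ln (2 * p) \<le> 0"
    using t(1) unfolding t_def by linarith
  then have nonneg: "0 \<le> p * (1 - ln (2 * p))"
    using p by (intro mult_nonneg_nonneg) linarith+
  have "{\<omega>\<in>space M. (X \<omega>, Y \<omega>) \<in> ?T} \<in> events"
    by measurable
  then have "emeasure M {\<omega>\<in>space M. (X \<omega>, Y \<omega>) \<in> ?T}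
      = (\<integral>\<^sup>+\<omega>. indicator {\<omega>\<in>space M. (X \<omega>, Y \<omega>) \<in> ?T} \<omega> \<partial>M)"
    by simp
  also have "\<dots> = (\<integral>\<^sup>+\<omega>. ennreal (1 + 0 * (X \<omega> - Y \<omega>)) * indicator ?T (X \<omega>, Y \<omega>) \<partial>M)"
    by (intro nn_integral_cong) (auto simp: indicator_def)
  also have "\<dots> = ennreal p"
    by (subst tail) (auto simp: t)
  finally have prob: "prob {\<omega>\<in>space M. (X \<omega>, Y \<omega>) \<in> ?T} = p"
    using p by (simp add: measure_def)
  have "expectation (\<lambda>\<omega>. indicator ?T (X \<omega>, Y \<omega>) * (X \<omega> - Y \<omega>))
      = enn2real (\<integral>\<^sup>+\<omega>. ennreal (indicator ?T (X \<omega>, Y \<omega>) * (X \<omega> - Y \<omega>)) \<partial>M)"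
    using t(1) by (intro integral_eq_nn_integral) (auto simp: indicator_def)
  also have "(\<integral>\<^sup>+\<omega>. ennreal (indicator ?T (X \<omega>, Y \<omega>) * (X \<omega> - Y \<omega>)) \<partial>M)
      = (\<integral>\<^sup>+\<omega>. ennreal (0 + 1 * (X \<omega> - Y \<omega>)) * indicator ?T (X \<omega>, Y \<omega>) \<partial>M)"
    by (intro nn_integral_cong) (auto simp: indicator_def)
  also have "\<dots> = ennreal ((t + 1) * p)"
    by (subst tail) (auto simp: t(2)[symmetric])
  also have "(t + 1) * p = p * (1 - ln (2 * p))"
    by (simp add: t_def algebra_simps)
  finally have "expectation (\<lambda>\<omega>. indicator ?T (X \<omega>, Y \<omega>) * (X \<omega> - Y \<omega>)) = p * (1 - ln (2 * p))"
    using nonneg by simp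
  with prob T bin_entropy_le_gain[OF p] show ?thesis
    unfolding switchable_def by (intro bexI[of _ ?T]) auto
qed

text \<open>For p > 1/2 the threshold - ln (2p) is negative, outside the range of the tail formula;
  there the rule that switches to \<open>Y\<close> with probability \<open>1 - p\<close> is
  complemented instead.\<close>

lemma switchable_exponential:
  assumes X: "distributed M lborel X (exponential_density 1)"
    and Y: "distributed M lborel Y (exponential_density 1)"
    and ind: "indep_var borel X borel Y" "indep_var borel Y borel X"
    and int: "integrable M X" "integrable M Y"
    and p: "0 < p" "p < 1"
  shows "switchable X Y p"
proof (cases "p \<le> 1/2")
  case True
  with assms show ?thesis
    by (intro switchable_exponential_le_half) auto
next
  case False
  then have "switchable Y X (1 - p)"
    using assms by (intro switchable_exponential_le_half) auto
  moreover have "expectation Y = expectation X"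
    using exponential_distributed_expectation[OF _ X] exponential_distributed_expectation[OF _ Y] by simp
  ultimately show ?thesis
    using switchable_swap[of Y X "1 - p"] int by simp
qed

text \<open>Following the rule gives a lower bound for \<open>F\<close>. In it \<open>A\<close> and
  \<open>B\<close> are multiplied by the indicator of the switch, and independence factors the
  expectations of these products.\<close>

lemma expectation_switch:
  assumes int: "integrable M X" "integrable M Y" "integrable M A" "integrable M B" "integrable M F"
    and indA: "\<And>T. T \<in> sets (borel \<Otimes>\<^sub>M borel) \<Longrightarrow>
      indep_var borel (\<lambda>\<omega>. indicator T (X \<omega>, Y \<omega>) :: real) borel A"
    and indB: "\<And>T. T \<in> sets (borel \<Otimes>\<^sub>M borel) \<Longrightarrow>
      indep_var borel (\<lambda>\<omega>. indicator T (X \<omega>, Y \<omega>) :: real) borel B"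
    and "switchable X Y p"
    and F: "\<And>\<omega>. X \<omega> + A \<omega> \<le> F \<omega>" "\<And>\<omega>. Y \<omega> + B \<omega> \<le> F \<omega>"
  shows "expectation Y + p * expectation A + (1 - p) * expectation B + bin_entropy p / 2 \<le> expectation F"
proof -
  have [measurable]: "X \<in> borel_measurable M" "Y \<in> borel_measurable M"
    using int by auto
  obtain T where T[measurable]: "T \<in> sets (borel \<Otimes>\<^sub>M borel)"
    and p: "prob {\<omega>\<in>space M. (X \<omega>, Y \<omega>) \<in> T} = p"
    and gain: "bin_entropy p / 2 \<le> expectation (\<lambda>\<omega>. indicator T (X \<omega>, Y \<omega>) * (X \<omega> - Y \<omega>))"
    using \<open>switchable X Y p\<close> unfolding switchable_def by blast
  let ?i = "\<lambda>\<omega>. indicator T (X \<omega>, Y \<omega>) :: real"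
  have i_int: "integrable M ?i"
    using integrable_indicator_mult[of X Y T "\<lambda>_. 1"] by simp
  have "expectation ?i = expectation (indicator {\<omega>\<in>space M. (X \<omega>, Y \<omega>) \<in> T})"
    by (intro Bochner_Integration.integral_cong) (auto simp: indicator_def)
  also have "\<dots> = p"
    using p by (subst Bochner_Integration.integral_indicator) (auto simp: Int_def conj_commute)
  finally have i_exp: "expectation ?i = p" .
  have mult: "expectation (\<lambda>\<omega>. ?i \<omega> * C \<omega>) = p * expectation C"
    if C: "integrable M C" and "indep_var borel ?i borel C" for C
    using indep_var_lebesgue_integral[OF that(2) i_int C] by (simp add: i_exp)
  have ints: "integrable M (\<lambda>\<omega>. ?i \<omega> * (X \<omega> - Y \<omega>))" "integrable M (\<lambda>\<omega>. ?i \<omega> * A \<omega>)"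
    "integrable M (\<lambda>\<omega>. ?i \<omega> * B \<omega>)"
    using int by (auto intro!: integrable_indicator_mult)
  have "expectation Y + expectation B + expectation (\<lambda>\<omega>. ?i \<omega> * (X \<omega> - Y \<omega>))
      + p * expectation A - p * expectation B
      = expectation (\<lambda>\<omega>. Y \<omega> + B \<omega> + ?i \<omega> * (X \<omega> - Y \<omega>) + ?i \<omega> * A \<omega> - ?i \<omega> * B \<omega>)"
    using int ints by (simp add: mult indA[OF T] indB[OF T])
  also have "\<dots> \<le> expectation F"
  proof (rule integral_mono)
    \<comment> \<open>On \<open>T\<close> the left side collapses to \<open>X + A\<close>, elsewhere
      to \<open>Y + B\<close>.\<close>
    show "Y \<omega> + B \<omega> + ?i \<omega> * (X \<omega> - Y \<omega>) + ?i \<omega> * A \<omega> - ?i \<omega> * B \<omega> \<le> F \<omega>" for \<omega>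
      using F[of \<omega>] by (auto simp: indicator_def)
  qed (use int ints in auto)
  finally show ?thesis
    using gain by (simp add: algebra_simps)
qed

text \<open>Functions of disjoint blocks of an independent family are independent: the rule reads
  \<open>e\<close> and \<open>e'\<close>, while \<open>a\<close> reads \<open>K\<close>. In the
  tree, \<open>K\<close> collects the edges further down.\<close>

lemma indep_var_pair_restrict:
  assumes ind: "indep_vars (\<lambda>_. borel) Z I" and "e \<in> I" "e' \<in> I" "K \<subseteq> I" "e \<notin> K" "e' \<notin> K"
    and a: "a \<in> borel_measurable (PiM K (\<lambda>_. borel))" and T[measurable]: "T \<in> sets (borel \<Otimes>\<^sub>M borel)"
  shows "indep_var borel (\<lambda>\<omega>. indicator T (Z e \<omega>, Z e' \<omega> :: real) :: real) borel (\<lambda>\<omega>. a (\<lambda>i\<in>K. Z i \<omega>))"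
proof -
  have "(\<lambda>f. indicator T (f e, f e') :: real) \<in> borel_measurable (PiM {e, e'} (\<lambda>_. borel))"
    by measurable
  then have "indep_var borel ((\<lambda>f. indicator T (f e, f e') :: real) \<circ> (\<lambda>\<omega>. \<lambda>i\<in>{e, e'}. Z i \<omega>))
     borel (a \<circ> (\<lambda>\<omega>. \<lambda>i\<in>K. Z i \<omega>))"
    using assms by (intro indep_var_compose[OF indep_var_restrict[OF ind]]) auto
  then show ?thesis
    by (simp add: comp_def)
qed

lemma indep_vars_imp_indep_var:
  assumes ind: "indep_vars (\<lambda>_. borel) Z I" and "e \<in> I" "e' \<in> I" "e \<noteq> e'"
  shows "indep_var borel (Z e) borel (Z e' :: 'a \<Rightarrow> real)"
proof -
  have "indep_var borel ((\<lambda>f. f e) \<circ> (\<lambda>\<omega>. \<lambda>i\<in>{e}. Z i \<omega>)) borel ((\<lambda>f. f e') \<circ> (\<lambda>\<omega>. \<lambda>i\<in>{e'}. Z i \<omega>))"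
    using assms by (intro indep_var_compose[OF indep_var_restrict[OF ind]]) auto
  then show ?thesis
    by (simp add: comp_def)
qed

end

subsection \<open>The tree of paths\<close>

lemma paths_from_Suc_0:
  assumes "v \<in> V"
  shows "paths_from V E v (Suc 0) = {[v]}"
  using assms by (auto simp: paths_from_def length_Suc_conv)

text \<open>The children of \<open>v\<close> in the tree of paths. \<open>V\<close> is the set of
  vertices still available; it shrinks along the path while \<open>E\<close> stays fixed.\<close>

definition free_nbrs :: "'a set \<Rightarrow> 'a set set \<Rightarrow> 'a \<Rightarrow> 'a set" where
  "free_nbrs V E v = {c \<in> V - {v}. {v, c} \<in> E}"

lemma paths_from_Suc:
  assumes "v \<in> V"
  shows "paths_from V E v (Suc (Suc k)) = (\<Union>c\<in>free_nbrs V E v. (#) v ` paths_from (V - {v}) E c (Suc k))"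
proof (intro equalityI subsetI)
  fix p assume p: "p \<in> paths_from V E v (Suc (Suc k))"
  then obtain c q where pq: "p = v # c # q"
    by (auto simp: paths_from_def length_Suc_conv)
  with p have "c \<in> free_nbrs V E v" "c # q \<in> paths_from (V - {v}) E c (Suc k)"
    by (auto simp: paths_from_def free_nbrs_def)
  then show "p \<in> (\<Union>c\<in>free_nbrs V E v. (#) v ` paths_from (V - {v}) E c (Suc k))"
    unfolding pq by blast
next
  fix p assume "p \<in> (\<Union>c\<in>free_nbrs V E v. (#) v ` paths_from (V - {v}) E c (Suc k))"
  then obtain c q where "c \<in> free_nbrs V E v" "q \<in> paths_from (V - {v}) E c (Suc k)" "p = v # q"
    by blast
  then show "p \<in> paths_from V E v (Suc (Suc k))"
    using assms by (cases q) (auto simp: paths_from_def free_nbrs_def)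
qed

lemma max_degree_le_mono: "max_degree_le V E d \<Longrightarrow> U \<subseteq> V \<Longrightarrow> max_degree_le U E d"
  by (auto simp: max_degree_le_def)

lemma finite_free_nbrs:
  assumes "max_degree_le V E d" "v \<in> V"
  shows "finite (free_nbrs V E v)"
  using assms by (auto simp: max_degree_le_def free_nbrs_def intro: rev_finite_subset)

lemma card_free_nbrs_le:
  assumes "max_degree_le V E d" "v \<in> V"
  shows "card (free_nbrs V E v) \<le> d"
proof -
  have "card (free_nbrs V E v) \<le> card {w. {v, w} \<in> E}"
    using assms by (intro card_mono) (auto simp: max_degree_le_def free_nbrs_def)
  with assms show ?thesis
    by (auto simp: max_degree_le_def intro: order_trans)
qed

text \<open>One of the at most \<open>Suc d\<close> edges at \<open>c\<close> leads back to
  \<open>v\<close>, which is used up. Degree 3 thus leaves at most two children below the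
  root.\<close>

lemma card_free_nbrs_child_le:
  assumes "max_degree_le V E (Suc d)" "c \<in> free_nbrs V E v"
  shows "card (free_nbrs (V - {v}) E c) \<le> d"
proof -
  have fin: "finite {w. {c, w} \<in> E}" and le: "card {w. {c, w} \<in> E} \<le> Suc d"
    using assms by (auto simp: max_degree_le_def free_nbrs_def)
  have "card (free_nbrs (V - {v}) E c) \<le> card ({w. {c, w} \<in> E} - {v})"
    using fin by (intro card_mono) (auto simp: free_nbrs_def)
  also have "\<dots> = card {w. {c, w} \<in> E} - 1"
    using assms fin by (subst card_Diff_singleton) (auto simp: free_nbrs_def insert_commute)
  finally show ?thesis
    using le by simp
qed

lemma finite_paths_from:
  assumes "max_degree_le V E d" "v \<in> V"
  shows "finite (paths_from V E v (Suc k))"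
  using assms
proof (induction k arbitrary: V v)
  case 0
  then show ?case
    by (simp add: paths_from_Suc_0)
next
  case (Suc k)
  have "finite (paths_from (V - {v}) E c (Suc k))" if "c \<in> free_nbrs V E v" for c
    using that Suc.prems by (intro Suc.IH) (auto simp: free_nbrs_def intro: max_degree_le_mono)
  with Suc.prems show ?case
    by (auto simp: paths_from_Suc intro: finite_free_nbrs)
qed

lemma num_paths_Suc:
  assumes "max_degree_le V E d" "v \<in> V"
  shows "num_paths V E v (Suc (Suc k)) = (\<Sum>c\<in>free_nbrs V E v. num_paths (V - {v}) E c (Suc k))"
  unfolding num_paths_def paths_from_Suc[OF assms(2)]
proof (subst card_UN_disjoint)
  show "finite (free_nbrs V E v)"
    by (rule finite_free_nbrs[OF assms])
  show "\<forall>c\<in>free_nbrs V E v. finite ((#) v ` paths_from (V - {v}) E c (Suc k))"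
  proof
    fix c assume "c \<in> free_nbrs V E v"
    with assms show "finite ((#) v ` paths_from (V - {v}) E c (Suc k))"
      by (intro finite_imageI finite_paths_from) (auto simp: free_nbrs_def intro: max_degree_le_mono)
  qed
  show "\<forall>c\<in>free_nbrs V E v. \<forall>c'\<in>free_nbrs V E v. c \<noteq> c' \<longrightarrow>
    (#) v ` paths_from (V - {v}) E c (Suc k) \<inter> (#) v ` paths_from (V - {v}) E c' (Suc k) = {}"
    by (auto simp: paths_from_def)
  show "(\<Sum>c\<in>free_nbrs V E v. card ((#) v ` paths_from (V - {v}) E c (Suc k)))
      = (\<Sum>c\<in>free_nbrs V E v. card (paths_from (V - {v}) E c (Suc k)))"
    by (intro sum.cong) (auto intro: card_image)
qed

lemma num_paths_pos:
  assumes "max_degree_le V E d" "v \<in> V" "paths_from V E v (Suc k) \<noteq> {}"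
  shows "0 < num_paths V E v (Suc k)"
  using assms(3) finite_paths_from[OF assms(1,2)] by (auto simp: num_paths_def card_gt_0_iff)

section \<open>Edges and extremal weights of paths\<close>

lemma path_edges_Cons:
  assumes "p \<noteq> []"
  shows "path_edges (v # p) = insert {v, hd p} (path_edges p)"
proof -
  have edges: "path_edges q = (\<lambda>i. {q ! i, q ! Suc i}) ` {..<length q - 1}" for q :: "'a list"
    by (auto simp: path_edges_def)
  have "path_edges (v # p) = (\<lambda>i. {(v # p) ! i, (v # p) ! Suc i}) ` {..<length p}"
    by (simp add: edges)
  also have "{..<length p} = insert 0 (Suc ` {..<length p - 1})"
    using assms by (simp add: lessThan_Suc_eq_insert_0[symmetric])
  also have "(\<lambda>i. {(v # p) ! i, (v # p) ! Suc i}) ` \<dots> = insert {v, hd p} (path_edges p)"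
    using assms unfolding edges image_insert image_image by (simp add: hd_conv_nth)
  finally show ?thesis .
qed

lemma finite_path_edges: "finite (path_edges p)"
proof -
  have "path_edges p = (\<lambda>i. {p ! i, p ! Suc i}) ` {i. Suc i < length p}"
    by (auto simp: path_edges_def)
  moreover have "finite {i. Suc i < length p}"
    by (rule finite_subset[of _ "{..<length p}"]) auto
  ultimately show ?thesis
    by simp
qed

lemma path_edges_subset_set: "e \<in> path_edges p \<Longrightarrow> e \<subseteq> set p"
  by (auto simp: path_edges_def)

lemma path_weight_Cons:
  assumes "p \<noteq> []" "v \<notin> set p"
  shows "path_weight w (v # p) = w {v, hd p} + path_weight w p"
proof -
  \<comment> \<open>Edges of \<open>p\<close> lie inside \<open>set p\<close>, which misses
    \<open>v\<close>; the first edge is therefore new to the edge set and adds its weight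
    once.\<close>
  have "{v, hd p} \<notin> path_edges p"
    using assms path_edges_subset_set by auto
  with assms show ?thesis
    by (simp add: path_weight_def path_edges_Cons finite_path_edges)
qed

lemma path_edges_subset:
  assumes "p \<in> paths_from V E v k"
  shows "path_edges p \<subseteq> {e \<in> E. e \<subseteq> V}"
  using assms unfolding paths_from_def path_edges_def successively_conv_nth by auto

lemma heaviest_weight_singleton:
  assumes "v \<in> V"
  shows "heaviest_weight V E v (Suc 0) w = 0"
  using assms by (simp add: heaviest_weight_def paths_from_Suc_0 path_weight_def path_edges_def)

text \<open>Prepending \<open>v\<close> to a heaviest path from \<open>c\<close> yields a
  competitor; nonemptiness makes \<open>Max\<close> an attained value.\<close>

lemma heaviest_weight_ge_step:
  assumes "max_degree_le V E d" "v \<in> V" "c \<in> free_nbrs V E v"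
    and ne: "paths_from (V - {v}) E c (Suc k) \<noteq> {}"
  shows "w {v, c} + heaviest_weight (V - {v}) E c (Suc k) w \<le> heaviest_weight V E v (Suc (Suc k)) w"
proof -
  have c: "c \<in> V - {v}"
    using assms by (auto simp: free_nbrs_def)
  have fin: "finite (paths_from (V - {v}) E c (Suc k))" "finite (paths_from V E v (Suc (Suc k)))"
    using finite_paths_from[OF max_degree_le_mono[OF assms(1)] c] finite_paths_from[OF assms(1,2)] by auto
  have "heaviest_weight (V - {v}) E c (Suc k) w \<in> path_weight w ` paths_from (V - {v}) E c (Suc k)"
    unfolding heaviest_weight_def using fin ne by (intro Max_in) auto
  then obtain p where p: "p \<in> paths_from (V - {v}) E c (Suc k)"
    "heaviest_weight (V - {v}) E c (Suc k) w = path_weight w p"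
    by blast
  then have "v # p \<in> paths_from V E v (Suc (Suc k))"
    using assms by (auto simp: paths_from_Suc)
  then have "path_weight w (v # p) \<le> heaviest_weight V E v (Suc (Suc k)) w"
    unfolding heaviest_weight_def using fin by (intro Max_ge) auto
  moreover have "path_weight w (v # p) = w {v, c} + path_weight w p"
    using p(1) by (subst path_weight_Cons) (auto simp: paths_from_def)
  ultimately show ?thesis
    using p(2) by simp
qed

text \<open>Only edges inside \<open>V\<close> matter. For \<open>V - {v}\<close> this leaves out
  every edge at \<open>v\<close>, which is what makes a subtree independent of the decision at
  \<open>v\<close>.\<close>

lemma heaviest_weight_restrict:
  assumes "{e \<in> E. e \<subseteq> V} \<subseteq> K"
  shows "heaviest_weight V E v k (\<lambda>e\<in>K. w e) = heaviest_weight V E v k w"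
proof -
  have "path_weight (\<lambda>e\<in>K. w e) p = path_weight w p" if "p \<in> paths_from V E v k" for p
    using path_edges_subset[OF that] assms unfolding path_weight_def by (intro sum.cong) auto
  then show ?thesis
    unfolding heaviest_weight_def by (simp cong: image_cong_simp)
qed

lemma heaviest_weight_measurable:
  assumes "finite (paths_from V E v k)" "{e \<in> E. e \<subseteq> V} \<subseteq> K"
  shows "heaviest_weight V E v k \<in> borel_measurable (PiM K (\<lambda>_. borel))"
proof -
  have "(\<lambda>w. path_weight w p) \<in> borel_measurable (PiM K (\<lambda>_. borel))" if "p \<in> paths_from V E v k" for p
    using path_edges_subset[OF that] assms(2) unfolding path_weight_def
    by (intro borel_measurable_sum measurable_component_singleton) auto
  then show ?thesis
    unfolding heaviest_weight_def[abs_def] by (intro borel_measurable_Max assms)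
qed

lemma heaviest_weight_integrable:
  assumes "finite (paths_from V E v k)" "paths_from V E v k \<noteq> {}"
    and "\<And>e. e \<in> E \<Longrightarrow> integrable M (Z e)"
  shows "integrable M (\<lambda>\<omega>. heaviest_weight V E v k (\<lambda>e. Z e \<omega>))"
proof -
  have "integrable M (\<lambda>\<omega>. path_weight (\<lambda>e. Z e \<omega>) p)" if "p \<in> paths_from V E v k" for p
    using path_edges_subset[OF that] assms(3) unfolding path_weight_def by auto
  then show ?thesis
    unfolding heaviest_weight_def using assms by (intro integrable_MAX) auto
qed

lemma lightest_weight_eq:
  assumes "finite (paths_from V E v k)" "paths_from V E v k \<noteq> {}"
  shows "lightest_weight V E v k w = - heaviest_weight V E v k (\<lambda>e. - w e)"
proof -
  have "path_weight (\<lambda>e. - w e) ` paths_from V E v k = uminus ` path_weight w ` paths_from V E v k"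
    by (simp add: path_weight_def sum_negf image_image)
  moreover have "- Min (path_weight w ` paths_from V E v k) = Max (uminus ` path_weight w ` paths_from V E v k)"
    using assms by (intro minus_Min_eq_Max) auto
  ultimately show ?thesis
    unfolding heaviest_weight_def lightest_weight_def by simp
qed

subsection \<open>Induction over the tree of paths\<close>

lemma finite_paths_from_child:
  assumes "max_degree_le V E d" "c \<in> free_nbrs V E v"
  shows "finite (paths_from (V - {v}) E c (Suc k))"
  using finite_paths_from[OF max_degree_le_mono[OF assms(1)], of "V - {v}" c k] assms(2)
  by (auto simp: free_nbrs_def)

text \<open>What the induction takes from the weights, so that it runs once for both extremes:
  \<open>m = 1\<close> for the weights themselves, \<open>m = - 1\<close> for their
  negatives.\<close>

locale switchable_weights = prob_space M
  for M :: "'b measure" and E :: "'a set set" and Z :: "'a set \<Rightarrow> 'b \<Rightarrow> real" and m :: real +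
  assumes indep: "indep_vars (\<lambda>_. borel) Z E"
    and integrable: "e \<in> E \<Longrightarrow> integrable M (Z e)"
    and mean: "e \<in> E \<Longrightarrow> expectation (Z e) = m"
    and switch: "e \<in> E \<Longrightarrow> e' \<in> E \<Longrightarrow> e \<noteq> e' \<Longrightarrow> 0 < p \<Longrightarrow> p < 1 \<Longrightarrow> switchable (Z e) (Z e') p"
begin

abbreviation "H V v k \<equiv> \<lambda>\<omega>. heaviest_weight V E v k (\<lambda>e. Z e \<omega>)"

text \<open>Descending into one fixed child: the edge contributes its mean and nothing is
  gained.\<close>

lemma expectation_heaviest_child:
  assumes deg: "max_degree_le V E d" and "v \<in> V" and c: "c \<in> free_nbrs V E v"
    and ne: "paths_from (V - {v}) E c (Suc k) \<noteq> {}"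
  shows "m + expectation (H (V - {v}) c (Suc k)) \<le> expectation (H V v (Suc (Suc k)))"
proof -
  have e: "{v, c} \<in> E"
    using c by (simp add: free_nbrs_def)
  have ne': "paths_from V E v (Suc (Suc k)) \<noteq> {}"
    using assms by (auto simp: paths_from_Suc)
  have ints: "integrable M (H (V - {v}) c (Suc k))" "integrable M (H V v (Suc (Suc k)))"
    using finite_paths_from_child[OF deg c] finite_paths_from[OF deg \<open>v \<in> V\<close>] ne ne'
    by (auto intro!: heaviest_weight_integrable integrable)
  have "m + expectation (H (V - {v}) c (Suc k)) = expectation (\<lambda>\<omega>. Z {v, c} \<omega> + H (V - {v}) c (Suc k) \<omega>)"
    using ints e integrable mean by simp
  also have "\<dots> \<le> expectation (H V v (Suc (Suc k)))"
    using ints e integrable by (intro integral_mono heaviest_weight_ge_step[OF deg \<open>v \<in> V\<close> c ne]) auto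
  finally show ?thesis .
qed

text \<open>Both subtree maxima read only edges inside \<open>V - {v}\<close>, so each is
  independent of the comparison of the two edges at \<open>v\<close>, even though the subtrees may
  share edges of the graph.\<close>

lemma expectation_heaviest_two_children:
  assumes deg: "max_degree_le V E d" and "v \<in> V" and ab: "a \<in> free_nbrs V E v" "b \<in> free_nbrs V E v" "a \<noteq> b"
    and ne: "paths_from (V - {v}) E a (Suc k) \<noteq> {}" "paths_from (V - {v}) E b (Suc k) \<noteq> {}"
    and p: "0 < p" "p < 1"
  shows "m + p * expectation (H (V - {v}) a (Suc k)) + (1 - p) * expectation (H (V - {v}) b (Suc k))
    + bin_entropy p / 2 \<le> expectation (H V v (Suc (Suc k)))"
proof -
  have e: "{v, a} \<in> E" "{v, b} \<in> E" "{v, a} \<noteq> {v, b}"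
    using ab by (auto simp: free_nbrs_def doubleton_eq_iff)
  have ne': "paths_from V E v (Suc (Suc k)) \<noteq> {}"
    using assms by (auto simp: paths_from_Suc)
  \<comment> \<open>One block serves both subtrees: all edges that avoid \<open>v\<close>.\<close>
  define K where "K = {e \<in> E. e \<subseteq> V - {v}}"
  have K: "K \<subseteq> E" "{v, a} \<notin> K" "{v, b} \<notin> K"
    by (auto simp: K_def)
  have fins: "finite (paths_from (V - {v}) E a (Suc k))" "finite (paths_from (V - {v}) E b (Suc k))"
    "finite (paths_from V E v (Suc (Suc k)))"
    using finite_paths_from_child[OF deg] finite_paths_from[OF deg \<open>v \<in> V\<close>] ab by auto
  have ind: "indep_var borel (\<lambda>\<omega>. indicator T (Z {v, a} \<omega>, Z {v, b} \<omega>) :: real) borel (H (V - {v}) c (Suc k))"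
    if "finite (paths_from (V - {v}) E c (Suc k))" "T \<in> sets (borel \<Otimes>\<^sub>M borel)" for c T
  proof -
    have "heaviest_weight (V - {v}) E c (Suc k) \<in> borel_measurable (PiM K (\<lambda>_. borel))"
      by (rule heaviest_weight_measurable) (use that in \<open>auto simp: K_def\<close>)
    from indep_var_pair_restrict[OF indep e(1,2) K this that(2)]
    show ?thesis
      by (subst (asm) heaviest_weight_restrict) (auto simp: K_def)
  qed
  have "expectation (Z {v, b}) + p * expectation (H (V - {v}) a (Suc k))
      + (1 - p) * expectation (H (V - {v}) b (Suc k)) + bin_entropy p / 2 \<le> expectation (H V v (Suc (Suc k)))"
  proof (rule expectation_switch[where X = "Z {v, a}" and Y = "Z {v, b}"
        and A = "H (V - {v}) a (Suc k)" and B = "H (V - {v}) b (Suc k)"])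
    show "integrable M (H (V - {v}) a (Suc k))" "integrable M (H (V - {v}) b (Suc k))"
      "integrable M (H V v (Suc (Suc k)))"
      using fins ne ne' by (auto intro!: heaviest_weight_integrable integrable)
    show "switchable (Z {v, a}) (Z {v, b}) p"
      using switch e p by blast
    show "Z {v, a} \<omega> + H (V - {v}) a (Suc k) \<omega> \<le> H V v (Suc (Suc k)) \<omega>" for \<omega>
      by (rule heaviest_weight_ge_step[OF deg \<open>v \<in> V\<close> ab(1) ne(1)])
    show "Z {v, b} \<omega> + H (V - {v}) b (Suc k) \<omega> \<le> H V v (Suc (Suc k)) \<omega>" for \<omega>
      by (rule heaviest_weight_ge_step[OF deg \<open>v \<in> V\<close> ab(2) ne(2)])
  qed (rule integrable e ind fins | assumption)+
  then show ?thesis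
    using mean e by simp
qed

text \<open>Each of the \<open>k\<close> edges contributes its mean and each branching half its
  entropy. With \<open>p\<close> the share of the leaves below \<open>a\<close>, the chain rule
  merges the two induction hypotheses into the logarithm of the total.\<close>

lemma expectation_heaviest_binary:
  assumes "max_degree_le V E 3" "v \<in> V" "card (free_nbrs V E v) \<le> 2" "paths_from V E v (Suc k) \<noteq> {}"
  shows "m * k + log 2 (num_paths V E v (Suc k)) / 2 \<le> expectation (H V v (Suc k))"
  using assms
proof (induction k arbitrary: V v)
  case 0
  then show ?case
    by (simp add: num_paths_def paths_from_Suc_0 heaviest_weight_singleton)
next
  case (Suc k)
  note deg = Suc.prems(1) and v = Suc.prems(2)
  let ?n = "\<lambda>c. num_paths (V - {v}) E c (Suc k)"
  \<comment> \<open>Dead ends are discarded: they hold no path, and \<open>Max\<close> of an empty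
    set would carry no information.\<close>
  define C where "C = {c \<in> free_nbrs V E v. paths_from (V - {v}) E c (Suc k) \<noteq> {}}"
  have fin: "finite (free_nbrs V E v)"
    by (rule finite_free_nbrs[OF deg v])
  have IH: "m * k + log 2 (?n c) / 2 \<le> expectation (H (V - {v}) c (Suc k))"
    and pos: "0 < ?n c" if "c \<in> C" for c
  proof -
    have c: "c \<in> free_nbrs V E v" "paths_from (V - {v}) E c (Suc k) \<noteq> {}" "c \<in> V - {v}"
      using that by (auto simp: C_def free_nbrs_def)
    have deg': "max_degree_le (V - {v}) E 3"
      using max_degree_le_mono[OF deg] by auto
    have "card (free_nbrs (V - {v}) E c) \<le> 2"
      using card_free_nbrs_child_le[of V E 2 c v] deg c by (simp add: numeral_3_eq_3 numeral_2_eq_2)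
    with deg' show "m * k + log 2 (?n c) / 2 \<le> expectation (H (V - {v}) c (Suc k))"
      using c by (intro Suc.IH)
    show "0 < ?n c"
      using num_paths_pos[OF deg' c(3,2)] .
  qed
  have num: "num_paths V E v (Suc (Suc k)) = sum ?n C"
    unfolding num_paths_Suc[OF deg v]
    by (rule sum.mono_neutral_right) (use fin in \<open>auto simp: C_def num_paths_def\<close>)
  have "card C \<le> 2"
    using card_mono[OF fin, of C] Suc.prems(3) by (auto simp: C_def)
  moreover have "C \<noteq> {}"
    using Suc.prems(4) v by (auto simp: C_def paths_from_Suc)
  moreover have "finite C"
    using fin by (simp add: C_def)
  ultimately have "card C = 1 \<or> card C = 2"
    by (auto simp: le_Suc_eq numeral_2_eq_2)
  then show ?case
  proof
    assume "card C = 1"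
    then obtain c where C: "C = {c}"
      by (auto simp: card_1_singleton_iff)
    then have "c \<in> free_nbrs V E v" "paths_from (V - {v}) E c (Suc k) \<noteq> {}"
      by (auto simp: C_def)
    from expectation_heaviest_child[OF deg v this] IH[of c] show ?thesis
      using num C by (simp add: algebra_simps)
  next
    assume "card C = 2"
    then obtain a b where C: "C = {a, b}" and "a \<noteq> b"
      by (auto simp: card_2_iff)
    then have ab: "a \<in> free_nbrs V E v" "b \<in> free_nbrs V E v" "paths_from (V - {v}) E a (Suc k) \<noteq> {}"
      "paths_from (V - {v}) E b (Suc k) \<noteq> {}"
      by (auto simp: C_def)
    define p where "p = real (?n a) / (real (?n a) + real (?n b))"
    have n: "0 < real (?n a)" "0 < real (?n b)"
      using pos C by auto
    then have p: "0 < p" "p < 1"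
      by (auto simp: p_def)
    have "m * Suc k + log 2 (num_paths V E v (Suc (Suc k))) / 2
        = m * Suc k + (p * log 2 (?n a) + (1 - p) * log 2 (?n b) + bin_entropy p) / 2"
      using log2_add_eq_bin_entropy[OF n p_def] \<open>a \<noteq> b\<close> by (simp add: num C)
    also have "\<dots> = m + p * (m * k + log 2 (?n a) / 2) + (1 - p) * (m * k + log 2 (?n b) / 2) + bin_entropy p / 2"
      by (simp add: field_simps)
    also have "\<dots> \<le> m + p * expectation (H (V - {v}) a (Suc k)) + (1 - p) * expectation (H (V - {v}) b (Suc k))
        + bin_entropy p / 2"
      using p IH C by (intro add_mono mult_left_mono order_refl) auto
    also have "\<dots> \<le> expectation (H V v (Suc (Suc k)))"
      using expectation_heaviest_two_children[OF deg v ab(1,2) \<open>a \<noteq> b\<close> ab(3,4) p] .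
    finally show ?thesis .
  qed
qed

text \<open>Only the first vertex of a path may have three free neighbours; keeping the best of them costs a
  factor of at most \<open>3\<close> in the number of paths.\<close>
lemma expectation_heaviest:
  assumes deg: "max_degree_le V E 3" and v: "v \<in> V" and ne: "paths_from V E v (Suc k) \<noteq> {}"
  shows "m * k + log 2 (num_paths V E v (Suc k)) / 2 - 1 \<le> expectation (H V v (Suc k))"
proof (cases k)
  case 0
  then show ?thesis
    using v by (simp add: num_paths_def paths_from_Suc_0 heaviest_weight_singleton)
next
  case (Suc l)
  let ?n = "\<lambda>c. num_paths (V - {v}) E c (Suc l)"
  let ?N = "num_paths V E v (Suc (Suc l))"
  have fin: "finite (free_nbrs V E v)"
    by (rule finite_free_nbrs[OF deg v])
  have N: "0 < ?N"
    using num_paths_pos[OF deg v] ne Suc by simp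
  \<comment> \<open>Pigeonhole: otherwise the at most three children together would hold fewer than
    \<open>?N\<close> paths.\<close>
  have "\<exists>c\<in>free_nbrs V E v. ?N \<le> 3 * ?n c"
  proof (rule ccontr)
    assume "\<not> ?thesis"
    then have less: "3 * ?n c < ?N" if "c \<in> free_nbrs V E v" for c
      using that by force
    have "free_nbrs V E v \<noteq> {}"
      using N by (auto simp: num_paths_Suc[OF deg v])
    then have "3 * ?N < (\<Sum>c\<in>free_nbrs V E v. ?N)"
      unfolding num_paths_Suc[OF deg v, of l] sum_distrib_left
      using fin less by (intro sum_strict_mono) (auto simp: num_paths_Suc[OF deg v, of l, symmetric])
    also have "\<dots> \<le> 3 * ?N"
      using card_free_nbrs_le[OF deg v] by simp
    finally show False
      by simp
  qed
  then obtain c where c: "c \<in> free_nbrs V E v" and le: "?N \<le> 3 * ?n c"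
    by blast
  then have pos: "0 < ?n c"
    using N by (cases "?n c") auto
  then have ne': "paths_from (V - {v}) E c (Suc l) \<noteq> {}"
    by (auto simp: num_paths_def)
  have "m * l + log 2 (?n c) / 2 \<le> expectation (H (V - {v}) c (Suc l))"
  proof (rule expectation_heaviest_binary)
    show "max_degree_le (V - {v}) E 3"
      using max_degree_le_mono[OF deg] by auto
    show "card (free_nbrs (V - {v}) E c) \<le> 2"
      using card_free_nbrs_child_le[of V E 2 c v] deg c by (simp add: numeral_3_eq_3 numeral_2_eq_2)
  qed (use c ne' in \<open>auto simp: free_nbrs_def\<close>)
  \<comment> \<open>The factor 3 is rounded up to 4, whose binary logarithm is 2; halved, this is
    the loss of 1.\<close>
  moreover have "log 2 ?N \<le> log 2 (4 * ?n c)"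
    using le N by (subst log_le_cancel_iff) auto
  then have "log 2 ?N \<le> 2 + log 2 (?n c)"
    using pos log_pow_cancel[of 2 2] by (simp add: log_mult)
  moreover note expectation_heaviest_child[OF deg v c ne']
  ultimately show ?thesis
    by (simp add: Suc algebra_simps)
qed

end

section \<open>Exponential weights and the asymptotic bounds\<close>

context prob_space
begin

lemma switchable_weights_exponential:
  assumes ind: "indep_vars (\<lambda>_. borel) W E"
    and dist: "\<And>e. e \<in> E \<Longrightarrow> distributed M lborel (W e) (exponential_density 1)"
  shows "switchable_weights M E W 1" "switchable_weights M E (\<lambda>e \<omega>. - W e \<omega>) (- 1)"
proof -
  have mean: "expectation (W e) = 1" if "e \<in> E" for e
    using exponential_distributed_expectation[OF _ dist[OF that]] by simp
  \<comment> \<open>The integral of a non-integrable function is 0 by convention, so mean 1 forces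
    integrability.\<close>
  have int: "integrable M (W e)" if "e \<in> E" for e
    using mean[OF that] not_integrable_integral_eq by fastforce
  have switch: "switchable (W e) (W e') p" if "e \<in> E" "e' \<in> E" "e \<noteq> e'" "0 < p" "p < 1" for e e' p
    using that by (intro switchable_exponential dist int indep_vars_imp_indep_var[OF ind]) auto
  show "switchable_weights M E W 1"
    by unfold_locales (use ind mean int switch in auto)
  have "indep_vars (\<lambda>_. borel) (\<lambda>e \<omega>. - W e \<omega>) E"
    by (rule indep_vars_compose2[OF ind, where Y = "\<lambda>_ x. - x"]) simp
  \<comment> \<open>Negation reverses the pair, hence \<open>switch\<close> enters with
    \<open>e\<close> and \<open>e'\<close> exchanged.\<close>
  then show "switchable_weights M E (\<lambda>e \<omega>. - W e \<omega>) (- 1)"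
    by unfold_locales (use mean int switch switchable_uminus in auto)
qed

text \<open>A path has \<open>k - 1\<close> edges and the root costs 1. For \<open>m = 1\<close>
  both losses add up to 2; for \<open>m = - 1\<close> the missing edge lowers the upper bound by 1
  and the two cancel.\<close>

lemma exponential_extremal_path_weights:
  assumes ind: "indep_vars (\<lambda>_. borel) W E"
    and dist: "\<And>e. e \<in> E \<Longrightarrow> distributed M lborel (W e) (exponential_density 1)"
    and deg: "max_degree_le V E 3" and v: "v \<in> V" and ne: "paths_from V E v k \<noteq> {}" and "k \<ge> 1"
  shows "real k + log 2 (num_paths V E v k) / 2 - 2 \<le> expectation (\<lambda>\<omega>. heaviest_weight V E v k (\<lambda>e. W e \<omega>))"
    and "expectation (\<lambda>\<omega>. lightest_weight V E v k (\<lambda>e. W e \<omega>)) \<le> real k - log 2 (num_paths V E v k) / 2"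
proof -
  obtain l where k: "k = Suc l"
    using \<open>k \<ge> 1\<close> by (cases k) auto
  note sw = switchable_weights_exponential[OF ind dist]
  show "real k + log 2 (num_paths V E v k) / 2 - 2 \<le> expectation (\<lambda>\<omega>. heaviest_weight V E v k (\<lambda>e. W e \<omega>))"
    using switchable_weights.expectation_heaviest[OF sw(1) deg v, of l] ne by (simp add: k)
  have "expectation (\<lambda>\<omega>. lightest_weight V E v k (\<lambda>e. W e \<omega>))
      = - expectation (\<lambda>\<omega>. heaviest_weight V E v k (\<lambda>e. - W e \<omega>))"
    using finite_paths_from[OF deg v] ne unfolding k by (simp add: lightest_weight_eq)
  then show "expectation (\<lambda>\<omega>. lightest_weight V E v k (\<lambda>e. W e \<omega>)) \<le> real k - log 2 (num_paths V E v k) / 2"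
    using switchable_weights.expectation_heaviest[OF sw(2) deg v, of l] ne by (simp add: k)
qed

end

theorem theorem1:
  fixes V :: "nat \<Rightarrow> 'a set" and E :: "nat \<Rightarrow> 'a set set"
    and u :: "nat \<Rightarrow> 'a" and k :: "nat \<Rightarrow> nat"
    and M :: "nat \<Rightarrow> 'b measure" and W :: "nat \<Rightarrow> 'a set \<Rightarrow> 'b \<Rightarrow> real"
  assumes "\<And>j. simple_graph (V j) (E j)"
    and "\<And>j. max_degree_le (V j) (E j) 3"
    and "\<And>j. k j \<ge> 1"
    and "\<And>j. u j \<in> V j"
    and "filterlim (\<lambda>j. num_paths (V j) (E j) (u j) (k j)) at_top sequentially"
    and "\<And>j. prob_space (M j)"
    and "\<And>j. prob_space.indep_vars (M j) (\<lambda>_. borel) (W j) (E j)"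
    and "\<And>j e. e \<in> E j \<Longrightarrow> distributed (M j) lborel (W j e) (exponential_density 1)"
  shows "(\<exists>\<epsilon> :: nat \<Rightarrow> real. \<epsilon> \<longlonglongrightarrow> 0 \<and>
           (\<forall>\<^sub>F j in sequentially.
              (\<integral>\<omega>. heaviest_weight (V j) (E j) (u j) (k j) (\<lambda>e. W j e \<omega>) \<partial>M j)
                \<ge> (1 - \<epsilon> j) * (real (k j) + log 2 (real (num_paths (V j) (E j) (u j) (k j))) / 2)))
       \<and> (\<exists>\<epsilon> :: nat \<Rightarrow> real. \<epsilon> \<longlonglongrightarrow> 0 \<and>
           (\<forall>\<^sub>F j in sequentially.
              (\<integral>\<omega>. lightest_weight (V j) (E j) (u j) (k j) (\<lambda>e. W j e \<omega>) \<partial>M j)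
                \<le> (1 + \<epsilon> j) * (real (k j) - log 2 (real (num_paths (V j) (E j) (u j) (k j))) / 2)))"
proof -
  let ?f = "\<lambda>j. num_paths (V j) (E j) (u j) (k j)"
  let ?s = "\<lambda>j. real (k j) + log 2 (real (?f j)) / 2"
  \<comment> \<open>Eventually there is a path at all, so that the extremal weights are
    meaningful.\<close>
  have f1: "\<forall>\<^sub>F j in sequentially. 1 \<le> ?f j"
    using assms(5) by (simp add: filterlim_at_top)
  have bounds: "?s j - 2 \<le> (\<integral>\<omega>. heaviest_weight (V j) (E j) (u j) (k j) (\<lambda>e. W j e \<omega>) \<partial>M j)"
    "(\<integral>\<omega>. lightest_weight (V j) (E j) (u j) (k j) (\<lambda>e. W j e \<omega>) \<partial>M j)
      \<le> real (k j) - log 2 (real (?f j)) / 2" if "1 \<le> ?f j" for j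
  proof -
    have "paths_from (V j) (E j) (u j) (k j) \<noteq> {}"
      using that by (auto simp: num_paths_def)
    then show "?s j - 2 \<le> (\<integral>\<omega>. heaviest_weight (V j) (E j) (u j) (k j) (\<lambda>e. W j e \<omega>) \<partial>M j)"
      "(\<integral>\<omega>. lightest_weight (V j) (E j) (u j) (k j) (\<lambda>e. W j e \<omega>) \<partial>M j)
        \<le> real (k j) - log 2 (real (?f j)) / 2"
      using assms by (auto intro!: prob_space.exponential_extremal_path_weights)
  qed
  have "filterlim (\<lambda>j. real (?f j)) at_top sequentially"
    using assms(5) by (rule filterlim_compose[OF filterlim_real_sequentially])
  then have "filterlim (\<lambda>j. log 2 (real (?f j)) / 2) at_top sequentially"
    by (rule filterlim_compose[rotated]) real_asymp
  then have s: "filterlim ?s at_top sequentially"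
    by (rule filterlim_at_top_mono) simp
  show ?thesis
  proof (intro conjI exI)
    \<comment> \<open>This error term turns the additive loss into a factor: (1 - 2/s) s = s -
      2.\<close>
    show "(\<lambda>j. 2 / ?s j) \<longlonglongrightarrow> 0"
      by (rule real_tendsto_divide_at_top[OF tendsto_const s])
    have "\<forall>\<^sub>F j in sequentially. 0 < ?s j"
      using s by (simp add: filterlim_at_top_dense)
    moreover have "(1 - 2 / x) * x = x - 2" if "0 < x" for x :: real
      using that by (simp add: left_diff_distrib)
    ultimately show "\<forall>\<^sub>F j in sequentially.
        (\<integral>\<omega>. heaviest_weight (V j) (E j) (u j) (k j) (\<lambda>e. W j e \<omega>) \<partial>M j) \<ge> (1 - 2 / ?s j) * ?s j"
      using f1 bounds(1) by (auto elim: eventually_elim2)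
    \<comment> \<open>The bound for lightest paths has no loss, so the zero error term
      suffices.\<close>
    show "(\<lambda>_. 0 :: real) \<longlonglongrightarrow> 0"
      by simp
    from f1 show "\<forall>\<^sub>F j in sequentially.
        (\<integral>\<omega>. lightest_weight (V j) (E j) (u j) (k j) (\<lambda>e. W j e \<omega>) \<partial>M j)
          \<le> (1 + 0) * (real (k j) - log 2 (real (?f j)) / 2)"
      by eventually_elim (use bounds(2) in simp)
  qed
qed

end
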